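(* Let $a<-1$ and use the notation of the context. Then $\mu=\mu^+_{\mathbf R}\wedge\mu^-_{\mathbf R}$; that is, the measure of maximal entropy $\mu=R_*\nu$ is the wedge (intersection) product of the stable current $\mu^+_{\mathbf R}$ and the unstable current $\mu^-_{\mathbf R}$.
   Context: Map. Fix a real number $a<-1$. Let $\overline{\mathbf R^2}=(\mathbf R\cup\{\infty\})^2$, with $+\infty$ and $-\infty$ identified to $\infty$ in each factor, and let $f(x,y)=\left(y\frac{x+a}{x-1},x+a-1\right)$, with $f^{-1}(x,y)=\left(y+1-a,x\frac{y-a}{y+1}\right)$, be viewed as a birational map of $\overline{\mathbf R^2}$. Put $I_+=\bigcup_{n\ge0}f^{-n}\{(1,0),(-a,\infty)\}$ and $I_-=\bigcup_{n\ge0}f^{n}\{(0,-1),(\infty,a)\}$. Words and rectangles. $R_0=[1,\infty]\times[-\infty,-1]$, $R_1=[-\infty,0]\times[0,\infty]$. $\Sigma\subset\{0,1\}^{\mathbf Z}$ is the set of sequences without the block $11$, with the shift $(\sigma w)_j=w_{j+1}$; $\Sigma_+$ (resp. $\Sigma_-$) is the set of one-sided sequences $(w_j)_{j\ge0}$ (resp. $(w_j)_{j\le0}$) without $11$, with the one-sided shift $\sigma^+$ (resp. $\sigma^-$), which deletes $w_0$ and re-indexes. For $w\in\Sigma$ write $w^+=(w_j)_{j\ge0}$, $w^-=(w_j)_{j\le0}$. For a finite block $w=w_{-n}\dots w_m$ ($n,m\ge0$) without $11$, $R(w)=\overline{\bigcap_{k=-n}^m f^{-k}(\operatorname{int}R_{w_k})}$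 (no point of $\operatorname{int}R_0\cup\operatorname{int}R_1$ is indeterminate for any iterate of $f^{\pm1}$). For an infinite word, $R(w)$ is the intersection of $R(w')$ over all its finite blocks $w'$ whose index range contains $0$. A word is alternating if its digits alternate between $0$ and $1$. $\Sigma'$ is the set of $w\in\Sigma$ such that neither $w^+$ nor $w^-$ is alternating; for $w\in\Sigma'$, $R(w)$ is a single point of $\mathbf R^2$. Measures. $\phi=(1+\sqrt5)/2$; $\nu$ is the unique $\sigma$-invariant probability measure on $\Sigma$ of entropy $\log\phi$ (the maximal entropy). It gives full mass to $\Sigma'$, and $\mu=R_*\nu$ is its push-forward under $w\mapsto R(w)$. $\nu^+$ is the unique $\sigma^+$-invariant measure on $\Sigma_+$ with entropy $\log\phi$ (the measure of maximal entropy), and $\nu^-$ is the analogous measure for $(\sigma^-,\Sigma_-)$. These measures are taken to be balanced, i.e. $\nu^\pm(E)=\phi^{-1}\nu^\pm(\sigma^\pm(E))$ whenever $E$ is measurable and $\sigma^\pm$ is injective on $E$, and $\nu$ is identified with $\nu^+\otimes\nu^-$ via the product structure $\Sigma\cong\{(v^+,v^-)\in\Sigma_+\times\Sigma_-:v^+_0=v^-_0\}$, $v\mapsto(v^+,v^-)$. Currents. If $w\in\Sigma_+$ (resp. $\Sigma_-$) is not alternating, $R(w)\cap\mathbf R^2$ is a monotone Lipschitz arc (an s-arc, resp. u-arc) in $R_{w_0}$, oriented to point down and to the right, and $[R(w)\cap\mathbf R^2]$ is its current of integration, acting on 1-forms. For $j=0,1$ put $\mu^\pm_j=\int[R(w)\cap\mathbf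 R^2]\,\nu^\pm(w)$, the direct integral over non-alternating $w\in\Sigma_\pm$ with $w_0=j$. The current $\mu^+_0+\mu^+_1$ extends to a closed current $\mu^+_{\mathbf R}$ on $\mathbf R^2\setminus I_+$ with $f^*\mu^+_{\mathbf R}=-\phi\,\mu^+_{\mathbf R}$, and similarly $\mu^-_0+\mu^-_1$ extends to a closed current $\mu^-_{\mathbf R}$ on $\mathbf R^2\setminus I_-$. Wedge product. For oriented arcs $\gamma_1,\gamma_2$ of finite length, $[\gamma_1]\wedge[\gamma_2]=0$ if they are disjoint, and $=\pm\delta_p$ if they intersect transversally at exactly one point $p$, with sign positive if the wedge product of the tangents at $p$ agrees with the orientation of the plane at $p$; each $R_j$ is oriented so that $[R(w^+)]\wedge[R(w^-)]=\delta_{R(w)}$ for $w\in\Sigma'$. The wedge product of direct integrals is the direct integral of the wedge products: $$\mu^+_{\mathbf R}\wedge\mu^-_{\mathbf R}=\int_{w\in\Sigma_+}\int_{\tilde w\in\Sigma_-}[R(w)]\wedge[R(\tilde w)]\;\nu^+(w)\otimes\nu^-(\tilde w)=\int_{\tilde w_0=w_0}\delta_{R(w)\cap R(\tilde w)}\;\nu^+(w)\otimes\nu^-(\tilde w).$$ *)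

theory Defs
  imports "HOL-Probability.Probability"
begin

section \<open>The birational map\<close>

type_synonym plane = "real \<times> real"
type_synonym ext_real = "real option"   \<comment> \<open>\<^term>\<open>None\<close> is the single point at infinity\<close>
type_synonym ext_plane = "ext_real \<times> ext_real"

definition ext_plane_topology :: "ext_plane topology" where
  "ext_plane_topology =
     prod_topology (Alexandroff_compactification euclideanreal)
                   (Alexandroff_compactification euclideanreal)"

definition emb :: "plane \<Rightarrow> ext_plane" where
  "emb p = (Some (fst p), Some (snd p))"

fun ext_shift :: "real \<Rightarrow> ext_real \<Rightarrow> ext_real" where
  "ext_shift c None = None"
| "ext_shift c (Some x) = Some (x + c)"

text \<open>The product is indeterminate for one factor \<open>0\<close> and the other \<open>\<infinity>\<close>. Below this occurs
  exactly at the indeterminate points, \<open>(1,0)\<close> and \<open>(-a,\<infinity>)\<close> for \<open>f\<close>, \<open>(0,-1)\<close> and \<open>(\<infinity>,a)\<close> for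
  the inverse map; the value given there is a dummy.\<close>

fun ext_mult :: "ext_real \<Rightarrow> ext_real \<Rightarrow> ext_real" where
  "ext_mult (Some x) (Some y) = Some (x * y)"
| "ext_mult _ _ = None"

text \<open>The Moebius map \<open>x \<mapsto> (x + b) / (x - c)\<close> for \<open>b \<noteq> -c\<close>.\<close>

fun ext_moebius :: "real \<Rightarrow> real \<Rightarrow> ext_real \<Rightarrow> ext_real" where
  "ext_moebius b c None = Some 1"
| "ext_moebius b c (Some x) = (if x = c then None else Some ((x + b) / (x - c)))"

definition f_ext :: "real \<Rightarrow> ext_plane \<Rightarrow> ext_plane" where
  "f_ext a = (\<lambda>(x, y). (ext_mult y (ext_moebius a 1 x), ext_shift (a - 1) x))"

definition finv_ext :: "real \<Rightarrow> ext_plane \<Rightarrow> ext_plane" where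
  "finv_ext a = (\<lambda>(x, y). (ext_shift (1 - a) y, ext_mult x (ext_moebius (-a) (-1) y)))"

definition f_iter :: "real \<Rightarrow> int \<Rightarrow> ext_plane \<Rightarrow> ext_plane" where
  "f_iter a k = (if k \<ge> 0 then f_ext a ^^ nat k else finv_ext a ^^ nat (- k))"

definition f_real :: "real \<Rightarrow> plane \<Rightarrow> plane" where
  "f_real a = (\<lambda>(x, y). (y * (x + a) / (x - 1), x + a - 1))"

definition finv_real :: "real \<Rightarrow> plane \<Rightarrow> plane" where
  "finv_real a = (\<lambda>(x, y). (y + 1 - a, x * (y - a) / (y + 1)))"

text \<open>\<open>f_real a\<close> is a diffeomorphism of \<open>f_dom a\<close> onto \<open>finv_dom a\<close>, with inverse
  \<open>finv_real a\<close>; the omitted lines are the poles and the contracted lines.\<close>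

definition f_dom :: "real \<Rightarrow> plane set" where
  "f_dom a = {(x, y). x \<noteq> 1 \<and> x \<noteq> - a}"

definition finv_dom :: "real \<Rightarrow> plane set" where
  "finv_dom a = {(x, y). y \<noteq> -1 \<and> y \<noteq> a}"

definition I_plus :: "real \<Rightarrow> ext_plane set" where
  "I_plus a = (\<Union>n. (finv_ext a ^^ n) ` {(Some 1, Some 0), (Some (- a), None)})"

definition I_minus :: "real \<Rightarrow> ext_plane set" where
  "I_minus a = (\<Union>n. (f_ext a ^^ n) ` {(Some 0, Some (-1)), (None, Some a)})"


section \<open>Words and rectangles\<close>

text \<open>Digits are Booleans, \<^term>\<open>False\<close> for 0 and \<^term>\<open>True\<close> for 1. A one-sided word is a
  function on \<^typ>\<open>nat\<close>: an element of \<open>\<Sigma>\<^sub>+\<close> is \<open>j \<mapsto> w\<^sub>j\<close>, while an element of \<open>\<Sigma>\<^sub>-\<close> is stored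
  reversed, as \<open>j \<mapsto> w\<^bsub>-j\<^esub>\<close>. With this encoding \<open>\<Sigma>\<^sub>+\<close> and \<open>\<Sigma>\<^sub>-\<close> are the same set
  \<open>Sigma_half\<close>, and both one-sided shifts are \<open>half_shift\<close>.\<close>

definition Sigma_full :: "(int \<Rightarrow> bool) set" where
  "Sigma_full = {w. \<forall>j. \<not> (w j \<and> w (j + 1))}"

definition Sigma_half :: "(nat \<Rightarrow> bool) set" where
  "Sigma_half = {w. \<forall>j. \<not> (w j \<and> w (Suc j))}"

definition full_shift :: "(int \<Rightarrow> bool) \<Rightarrow> int \<Rightarrow> bool" where
  "full_shift w = (\<lambda>j. w (j + 1))"

definition half_shift :: "(nat \<Rightarrow> bool) \<Rightarrow> nat \<Rightarrow> bool" where
  "half_shift w = (\<lambda>j. w (Suc j))"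

definition word_plus :: "(int \<Rightarrow> bool) \<Rightarrow> nat \<Rightarrow> bool" where
  "word_plus w = (\<lambda>j. w (int j))"

definition word_minus :: "(int \<Rightarrow> bool) \<Rightarrow> nat \<Rightarrow> bool" where
  "word_minus w = (\<lambda>j. w (- int j))"

definition alternating :: "(nat \<Rightarrow> bool) \<Rightarrow> bool" where
  "alternating w \<longleftrightarrow> (\<forall>j. w (Suc j) \<noteq> w j)"

definition Sigma_half_nonalt :: "(nat \<Rightarrow> bool) set" where
  "Sigma_half_nonalt = {w \<in> Sigma_half. \<not> alternating w}"

definition Sigma' :: "(int \<Rightarrow> bool) set" where
  "Sigma' = {w \<in> Sigma_full. \<not> alternating (word_plus w) \<and> \<not> alternating (word_minus w)}"

text \<open>\<open>[c,\<infinity>]\<close> and \<open>[-\<infinity>,c]\<close>.\<close>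

definition ext_ge :: "real \<Rightarrow> ext_real set" where
  "ext_ge c = insert None (Some ` {c..})"

definition ext_le :: "real \<Rightarrow> ext_real set" where
  "ext_le c = insert None (Some ` {..c})"

definition rect :: "bool \<Rightarrow> ext_plane set" where
  "rect d = (if d then ext_le 0 \<times> ext_ge 0 else ext_ge 1 \<times> ext_le (-1))"

definition int_rect :: "bool \<Rightarrow> ext_plane set" where
  "int_rect d = ext_plane_topology interior_of (rect d)"

text \<open>\<open>block_rect a m n w\<close> is the rectangle of the finite block \<open>w\<^sub>m \<dots> w\<^sub>n\<close>, \<open>m \<le> 0 \<le> n\<close>.\<close>

definition block_rect :: "real \<Rightarrow> int \<Rightarrow> int \<Rightarrow> (int \<Rightarrow> bool) \<Rightarrow> ext_plane set" where
  "block_rect a m n w =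
     ext_plane_topology closure_of (\<Inter>k\<in>{m..n}. f_iter a k -` int_rect (w k))"

definition R_full :: "real \<Rightarrow> (int \<Rightarrow> bool) \<Rightarrow> ext_plane set" where
  "R_full a w = (\<Inter>m\<in>{..0}. \<Inter>n\<in>{0..}. block_rect a m n w)"

definition R_plus :: "real \<Rightarrow> (nat \<Rightarrow> bool) \<Rightarrow> ext_plane set" where
  "R_plus a w = (\<Inter>n\<in>{0..}. block_rect a 0 n (\<lambda>k. w (nat k)))"

definition R_minus :: "real \<Rightarrow> (nat \<Rightarrow> bool) \<Rightarrow> ext_plane set" where
  "R_minus a w = (\<Inter>m\<in>{..0}. block_rect a m 0 (\<lambda>k. w (nat (- k))))"

text \<open>Meaningful for \<open>w \<in> \<Sigma>'\<close>, where \<open>R(w)\<close> is a single point of the affine plane.\<close>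

definition R_point :: "real \<Rightarrow> (int \<Rightarrow> bool) \<Rightarrow> plane" where
  "R_point a w = (THE p. R_full a w = {emb p})"


section \<open>Measures\<close>

definition golden :: real where
  "golden = (1 + sqrt 5) / 2"

definition Sigma_full_algebra :: "(int \<Rightarrow> bool) measure" where
  "Sigma_full_algebra = restrict_space (\<Pi>\<^sub>M _\<in>UNIV. count_space UNIV) Sigma_full"

definition Sigma_half_algebra :: "(nat \<Rightarrow> bool) measure" where
  "Sigma_half_algebra = restrict_space (\<Pi>\<^sub>M _\<in>UNIV. count_space UNIV) Sigma_half"

definition invariant_under :: "'a measure \<Rightarrow> ('a \<Rightarrow> 'a) \<Rightarrow> bool" where
  "invariant_under M T \<longleftrightarrow> T \<in> measurable M M \<and> distr M M T = M"

text \<open>Kolmogorov-Sinai entropy, in nats. A finite measurable partition is given by the level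
  sets of a simple function \<open>\<xi>\<close>, its refinement under \<open>T\<close> by the \<open>n\<close>-names.\<close>

definition itinerary :: "('a \<Rightarrow> 'a) \<Rightarrow> ('a \<Rightarrow> nat) \<Rightarrow> nat \<Rightarrow> 'a \<Rightarrow> nat list" where
  "itinerary T \<xi> n x = map (\<lambda>i. \<xi> ((T ^^ i) x)) [0..<n]"

definition ks_entropy :: "'a measure \<Rightarrow> ('a \<Rightarrow> 'a) \<Rightarrow> ereal" where
  "ks_entropy M T =
     (SUP \<xi>\<in>{\<xi>. simple_function M \<xi>}.
        lim (\<lambda>n. ereal (prob_space.entropy M (exp 1)
          (count_space (itinerary T \<xi> n ` space M)) (itinerary T \<xi> n) / real n)))"

definition is_max_entropy_measure :: "(int \<Rightarrow> bool) measure \<Rightarrow> bool" where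
  "is_max_entropy_measure \<nu> \<longleftrightarrow>
     prob_space \<nu> \<and> sets \<nu> = sets Sigma_full_algebra \<and>
     invariant_under \<nu> full_shift \<and> ks_entropy \<nu> full_shift = ereal (ln golden)"

text \<open>The measures on \<open>\<Sigma>\<^sub>+\<close> and \<open>\<Sigma>\<^sub>-\<close> are normalised to be balanced. A nonzero balanced finite
  measure is not itself shift-invariant (balance gives \<open>\<nu>[1] = \<nu>[10] = \<nu>[0]/\<phi>\<close>, hence
  \<open>\<nu>(\<sigma>\<^sup>-\<^sup>1[0]) = \<nu>[00] + \<nu>[10] = 2\<nu>[0]/\<phi>\<close>): it is the representative, in the measure class of the
  invariant measure of maximal entropy, whose Jacobian is constant. Balance determines it up
  to a factor.\<close>

definition is_balanced_measure :: "(nat \<Rightarrow> bool) measure \<Rightarrow> bool" where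
  "is_balanced_measure M \<longleftrightarrow>
     finite_measure M \<and> sets M = sets Sigma_half_algebra \<and>
     (\<forall>E\<in>sets M. inj_on half_shift E \<longrightarrow>
        emeasure M E = ennreal (1 / golden) * emeasure M (half_shift ` E))"

text \<open>\<open>\<nu> = \<nu>\<^sup>+ \<otimes> \<nu>\<^sup>-\<close> under \<open>v \<mapsto> (v\<^sup>+, v\<^sup>-)\<close>, which maps \<open>\<Sigma>\<close> onto the pairs with a common digit at
  index 0. This fixes the product of the normalising factors of \<open>\<nu>\<^sup>+\<close> and \<open>\<nu>\<^sup>-\<close>.\<close>

definition has_product_structure ::
  "(int \<Rightarrow> bool) measure \<Rightarrow> (nat \<Rightarrow> bool) measure \<Rightarrow> (nat \<Rightarrow> bool) measure \<Rightarrow> bool" where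
  "has_product_structure \<nu> \<nu>p \<nu>m \<longleftrightarrow>
     (\<forall>E\<in>sets (\<nu>p \<Otimes>\<^sub>M \<nu>m).
        emeasure \<nu> {v \<in> space \<nu>. (word_plus v, word_minus v) \<in> E} =
        emeasure (\<nu>p \<Otimes>\<^sub>M \<nu>m) {(u, v) \<in> E. u 0 = v 0})"

text \<open>\<open>\<mu> = R\<^sub>*\<nu>\<close>; the restriction to \<open>\<Sigma>'\<close> discards a null set on which \<open>R\<close> is not point-valued.\<close>

definition mu :: "real \<Rightarrow> (int \<Rightarrow> bool) measure \<Rightarrow> plane measure" where
  "mu a \<nu> = distr (restrict_space \<nu> Sigma') borel (R_point a)"


section \<open>Test forms and currents\<close>

text \<open>The value \<open>(P, Q)\<close> of a form at a point stands for \<open>P dx + Q dy\<close>.\<close>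

type_synonym form = "plane \<Rightarrow> real \<times> real"

definition dir_deriv :: "plane \<Rightarrow> (plane \<Rightarrow> real) \<Rightarrow> plane \<Rightarrow> real" where
  "dir_deriv v g = (\<lambda>p. frechet_derivative g (at p) v)"

definition smooth :: "(plane \<Rightarrow> real) \<Rightarrow> bool" where
  "smooth g \<longleftrightarrow> (\<forall>vs. foldr dir_deriv vs g differentiable_on UNIV)"

definition compact_support_in :: "plane set \<Rightarrow> (plane \<Rightarrow> 'b::zero) \<Rightarrow> bool" where
  "compact_support_in U g \<longleftrightarrow>
     compact (closure {p. g p \<noteq> 0}) \<and> closure {p. g p \<noteq> 0} \<subseteq> U"

definition test_form :: "plane set \<Rightarrow> form \<Rightarrow> bool" where
  "test_form U \<eta> \<longleftrightarrow> smooth (fst \<circ> \<eta>) \<and> smooth (snd \<circ> \<eta>) \<and> compact_support_in U \<eta>"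

definition differential :: "(plane \<Rightarrow> real) \<Rightarrow> form" where
  "differential \<psi> p = (dir_deriv (1, 0) \<psi> p, dir_deriv (0, 1) \<psi> p)"

definition current_on :: "plane set \<Rightarrow> (form \<Rightarrow> real) \<Rightarrow> bool" where
  "current_on U S \<longleftrightarrow>
     (\<forall>\<eta> \<theta>. test_form U \<eta> \<longrightarrow> test_form U \<theta> \<longrightarrow> S (\<lambda>p. \<eta> p + \<theta> p) = S \<eta> + S \<theta>) \<and>
     (\<forall>\<eta> c. test_form U \<eta> \<longrightarrow> S (\<lambda>p. c *\<^sub>R \<eta> p) = c * S \<eta>) \<and>
     (\<forall>K E. compact K \<longrightarrow> K \<subseteq> U \<longrightarrow> (\<forall>n. test_form K (E n)) \<longrightarrow>
        (\<forall>vs. uniform_limit UNIV (\<lambda>n. foldr dir_deriv vs (fst \<circ> E n)) (\<lambda>_. 0) sequentially \<and>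
              uniform_limit UNIV (\<lambda>n. foldr dir_deriv vs (snd \<circ> E n)) (\<lambda>_. 0) sequentially) \<longrightarrow>
        (\<lambda>n. S (E n)) \<longlonglongrightarrow> 0)"

definition closed_current_on :: "plane set \<Rightarrow> (form \<Rightarrow> real) \<Rightarrow> bool" where
  "closed_current_on U S \<longleftrightarrow> current_on U S \<and>
     (\<forall>\<psi>. smooth \<psi> \<longrightarrow> compact_support_in U \<psi> \<longrightarrow> S (differential \<psi>) = 0)"

text \<open>Pull-back of a form by \<open>h\<close>, extended by zero outside \<open>V\<close>.\<close>

definition pull_form :: "(plane \<Rightarrow> plane) \<Rightarrow> plane set \<Rightarrow> form \<Rightarrow> form" where
  "pull_form h V \<eta> q =
     (if q \<in> V
      then (\<eta> (h q) \<bullet> frechet_derivative h (at q) (1, 0),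
            \<eta> (h q) \<bullet> frechet_derivative h (at q) (0, 1))
      else 0)"

text \<open>The pull-back of a current by a diffeomorphism \<open>g\<close> is the push-forward by its inverse
  \<open>h\<close>, whose domain is \<open>V\<close>: \<open>\<langle>g\<^sup>*S, \<eta>\<rangle> = \<langle>S, h\<^sup>*\<eta>\<rangle>\<close>. Thus \<open>g\<^sup>*[\<gamma>] = [h \<circ> \<gamma>]\<close>, without a sign
  depending on whether \<open>g\<close> preserves the orientation of the plane.\<close>

definition pull_current ::
  "(plane \<Rightarrow> plane) \<Rightarrow> plane set \<Rightarrow> (form \<Rightarrow> real) \<Rightarrow> form \<Rightarrow> real" where
  "pull_current h V S \<eta> = S (pull_form h V \<eta>)"


section \<open>Oriented arcs and direct integrals\<close>

text \<open>An oriented arc is its set of points together with the order in which it runs through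
  them.\<close>

type_synonym oriented_arc = "plane set \<times> (plane \<Rightarrow> plane \<Rightarrow> bool)"

definition down_right :: "plane \<Rightarrow> plane \<Rightarrow> bool" where
  "down_right p q \<longleftrightarrow> fst p \<le> fst q \<and> snd q \<le> snd p"

definition real_part :: "ext_plane set \<Rightarrow> plane set" where
  "real_part S = emb -` S"

definition s_arc :: "real \<Rightarrow> (nat \<Rightarrow> bool) \<Rightarrow> oriented_arc" where
  "s_arc a w = (real_part (R_plus a w), down_right)"

definition u_arc :: "real \<Rightarrow> (nat \<Rightarrow> bool) \<Rightarrow> oriented_arc" where
  "u_arc a w = (real_part (R_minus a w), down_right)"

definition arc_param :: "oriented_arc \<Rightarrow> real set \<Rightarrow> (real \<Rightarrow> plane) \<Rightarrow> bool" where
  "arc_param \<gamma> I g \<longleftrightarrow>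
     is_interval I \<and> (\<exists>C. C-lipschitz_on I g) \<and> bij_betw g I (fst \<gamma>) \<and>
     (\<forall>s\<in>I. \<forall>t\<in>I. s < t \<longrightarrow> snd \<gamma> (g s) (g t))"

text \<open>The current of integration: the common value of the line integral over all Lipschitz
  parametrisations.\<close>

definition arc_current :: "oriented_arc \<Rightarrow> form \<Rightarrow> real" where
  "arc_current \<gamma> \<eta> =
     (THE c. \<forall>I g. arc_param \<gamma> I g \<longrightarrow>
        c = (LBINT t:I. \<eta> (g t) \<bullet> vector_derivative g (at t within I)))"

definition direct_integral :: "'i measure \<Rightarrow> ('i \<Rightarrow> oriented_arc) \<Rightarrow> form \<Rightarrow> real" where
  "direct_integral M \<gamma> \<eta> = (\<integral>i. arc_current (\<gamma> i) \<eta> \<partial>M)"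

definition mu_plus :: "real \<Rightarrow> (nat \<Rightarrow> bool) measure \<Rightarrow> bool \<Rightarrow> form \<Rightarrow> real" where
  "mu_plus a \<nu>p d = direct_integral (restrict_space \<nu>p {w \<in> Sigma_half_nonalt. w 0 = d}) (s_arc a)"

definition mu_minus :: "real \<Rightarrow> (nat \<Rightarrow> bool) measure \<Rightarrow> bool \<Rightarrow> form \<Rightarrow> real" where
  "mu_minus a \<nu>m d = direct_integral (restrict_space \<nu>m {w \<in> Sigma_half_nonalt. w 0 = d}) (u_arc a)"

text \<open>Wedge products are computed from the presentation of a current as a direct integral of
  arcs, so this presentation is part of the data.\<close>

record 'i presented_current =
  functional :: "form \<Rightarrow> real"
  index :: "'i measure"
  leaf :: "'i \<Rightarrow> oriented_arc"

text \<open>The functional equations are tested where \<open>f_real a\<close> is a diffeomorphism; for \<open>S\<close> unstable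
  it is \<open>(f\<^sup>-\<^sup>1)\<^sup>*S = -\<phi> S\<close>.\<close>

definition is_stable_current ::
  "real \<Rightarrow> (nat \<Rightarrow> bool) measure \<Rightarrow> (nat \<Rightarrow> bool) presented_current \<Rightarrow> bool" where
  "is_stable_current a \<nu>p S \<longleftrightarrow>
     index S = restrict_space \<nu>p Sigma_half_nonalt \<and> leaf S = s_arc a \<and>
     closed_current_on (UNIV - real_part (I_plus a)) (functional S) \<and>
     (\<forall>\<eta>. test_form (real_part (int_rect False \<union> int_rect True)) \<eta> \<longrightarrow>
        functional S \<eta> = mu_plus a \<nu>p False \<eta> + mu_plus a \<nu>p True \<eta>) \<and>
     (\<forall>\<eta>. test_form (f_dom a - real_part (I_plus a)) \<eta> \<longrightarrow>
        pull_current (finv_real a) (finv_dom a) (functional S) \<eta> = - golden * functional S \<eta>)"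

definition is_unstable_current ::
  "real \<Rightarrow> (nat \<Rightarrow> bool) measure \<Rightarrow> (nat \<Rightarrow> bool) presented_current \<Rightarrow> bool" where
  "is_unstable_current a \<nu>m S \<longleftrightarrow>
     index S = restrict_space \<nu>m Sigma_half_nonalt \<and> leaf S = u_arc a \<and>
     closed_current_on (UNIV - real_part (I_minus a)) (functional S) \<and>
     (\<forall>\<eta>. test_form (real_part (int_rect False \<union> int_rect True)) \<eta> \<longrightarrow>
        functional S \<eta> = mu_minus a \<nu>m False \<eta> + mu_minus a \<nu>m True \<eta>) \<and>
     (\<forall>\<eta>. test_form (finv_dom a - real_part (I_minus a)) \<eta> \<longrightarrow>
        pull_current (f_real a) (f_dom a) (functional S) \<eta> = - golden * functional S \<eta>)"


section \<open>Wedge products\<close>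

text \<open>The arcs are only Lipschitz, so a tangent direction at \<open>p\<close> is any limit of unit secants
  through \<open>p\<close>, pointing in the direction of the arc. If the arc has a tangent at \<open>p\<close> in the
  usual sense, that is the only one.\<close>

definition oriented_secant :: "oriented_arc \<Rightarrow> plane \<Rightarrow> plane \<Rightarrow> plane" where
  "oriented_secant \<gamma> p q = (if snd \<gamma> p q then sgn (q - p) else sgn (p - q))"

definition arc_tangents :: "oriented_arc \<Rightarrow> plane \<Rightarrow> plane set" where
  "arc_tangents \<gamma> p =
     {v. \<exists>q. (\<forall>n. q n \<in> fst \<gamma> - {p}) \<and> q \<longlonglongrightarrow> p \<and> (\<lambda>n. oriented_secant \<gamma> p (q n)) \<longlonglongrightarrow> v}"

definition wedge2 :: "plane \<Rightarrow> plane \<Rightarrow> real" where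
  "wedge2 v w = fst v * snd w - snd v * fst w"

text \<open>\<open>meet_transversally ori \<epsilon> \<gamma>\<^sub>1 \<gamma>\<^sub>2 p\<close>: the arcs meet exactly at \<open>p\<close>, transversally and with sign
  \<open>\<epsilon>\<close>, where \<open>ori p = \<plusminus>1\<close> is the orientation of the plane at \<open>p\<close> relative to \<open>dx \<and> dy\<close>.\<close>

definition meet_transversally ::
  "(plane \<Rightarrow> real) \<Rightarrow> real \<Rightarrow> oriented_arc \<Rightarrow> oriented_arc \<Rightarrow> plane \<Rightarrow> bool" where
  "meet_transversally ori \<epsilon> \<gamma>1 \<gamma>2 p \<longleftrightarrow>
     fst \<gamma>1 \<inter> fst \<gamma>2 = {p} \<and> arc_tangents \<gamma>1 p \<noteq> {} \<and> arc_tangents \<gamma>2 p \<noteq> {} \<and>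
     (\<forall>v\<in>arc_tangents \<gamma>1 p. \<forall>w\<in>arc_tangents \<gamma>2 p. \<epsilon> * ori p * wedge2 v w > 0)"

text \<open>The signed measure \<open>[\<gamma>\<^sub>1] \<and> [\<gamma>\<^sub>2]\<close>, as a set function. It is used for arcs which are
  disjoint or meet transversally at exactly one point, and set to zero otherwise.\<close>

definition arc_wedge ::
  "(plane \<Rightarrow> real) \<Rightarrow> oriented_arc \<Rightarrow> oriented_arc \<Rightarrow> plane set \<Rightarrow> real" where
  "arc_wedge ori \<gamma>1 \<gamma>2 A =
     (if \<exists>p\<in>A. meet_transversally ori 1 \<gamma>1 \<gamma>2 p then 1
      else if \<exists>p\<in>A. meet_transversally ori (-1) \<gamma>1 \<gamma>2 p then -1
      else 0)"

definition has_wedge_product ::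
  "(plane \<Rightarrow> real) \<Rightarrow> 'i presented_current \<Rightarrow> 'j presented_current \<Rightarrow> plane measure \<Rightarrow> bool" where
  "has_wedge_product ori S T m \<longleftrightarrow>
     finite_measure m \<and> sets m = sets borel \<and>
     (\<forall>A\<in>sets borel.
        has_bochner_integral (index S \<Otimes>\<^sub>M index T)
          (\<lambda>(i, j). arc_wedge ori (leaf S i) (leaf T j) A) (measure m A))"

text \<open>The plane is given one orientation on each of the two (disjoint) rectangles; no arcs meet
  elsewhere.\<close>

definition plane_orientation :: "(bool \<Rightarrow> real) \<Rightarrow> plane \<Rightarrow> real" where
  "plane_orientation ori p = ori (emb p \<in> rect True)"

text \<open>The orientations of the two rectangles are the ones for which
  \<open>[R(w\<^sup>+)] \<and> [R(w\<^sup>-)] = \<delta>\<^bsub>R(w)\<^esub>\<close> for all \<open>w \<in> \<Sigma>'\<close>. They differ: on \<open>rect False\<close> the s-arcs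
  are steeper than the u-arcs, on \<open>rect True\<close> it is the other way round.\<close>

definition is_rect_orientation :: "real \<Rightarrow> (bool \<Rightarrow> real) \<Rightarrow> bool" where
  "is_rect_orientation a ori \<longleftrightarrow>
     (\<forall>d. ori d = 1 \<or> ori d = -1) \<and>
     (\<forall>w\<in>Sigma'. \<forall>A\<in>sets borel.
        arc_wedge (plane_orientation ori) (s_arc a (word_plus w)) (u_arc a (word_minus w)) A
          = indicator A (R_point a w))"

end

theory Submission
  imports Defs
begin

text \<open>A word of \<open>\<Sigma>'\<close> is a pair of non-alternating half-words with a common digit at index 0, so the
  product structure of \<open>\<nu>\<close> turns \<open>\<nu>\<close> into \<open>\<nu>\<^sup>+ \<otimes> \<nu>\<^sup>-\<close> on such pairs. On them the wedge product of
  the two leaves is the point mass at \<open>R(w)\<close>, by the choice of the orientations; leaves with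
  different digits at index 0 lie in disjoint rectangles and do not meet. The analytic content is the
  measurability of \<open>w \<mapsto> R(w)\<close>: for compact \<open>K\<close>, the condition \<open>R(w) \<in> K\<close> says that the two arcs
  meet inside \<open>K\<close>, which by compactness is a countable conjunction of conditions on finite blocks.\<close>

section \<open>Rectangles in the affine plane\<close>

lemma continuous_map_emb: "continuous_map euclidean ext_plane_topology emb"
proof -
  have "continuous_map euclidean (Alexandroff_compactification euclideanreal) (\<lambda>p::plane. Some (fst p))"
       "continuous_map euclidean (Alexandroff_compactification euclideanreal) (\<lambda>p::plane. Some (snd p))"
    using continuous_map_compose[OF _ continuous_map_Some, of euclidean euclideanreal "fst :: plane \<Rightarrow> real"]
      continuous_map_compose[OF _ continuous_map_Some, of euclidean euclideanreal "snd :: plane \<Rightarrow> real"]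
    by (auto simp: o_def continuous_on_fst continuous_on_snd)
  then show ?thesis
    unfolding ext_plane_topology_def emb_def by (simp add: continuous_map_pairedI)
qed

lemma closed_real_part:
  assumes "closedin ext_plane_topology S"
  shows "closed (real_part S)"
  using closedin_continuous_map_preimage[OF continuous_map_emb assms]
  by (simp add: real_part_def vimage_def)

lemma closed_real_part_block_rect: "closed (real_part (block_rect a m n w))"
  unfolding block_rect_def by (intro closed_real_part closedin_closure_of)

text \<open>Each side of a rectangle is the complement of an open ray of finite points. Such a ray
  remains open in the one-point compactification because it misses infinity.\<close>

lemma closedin_rect: "closedin ext_plane_topology (rect d)"
proof -
  have "ext_ge c = topspace (Alexandroff_compactification euclideanreal) - Some ` {..<c}"
       "ext_le c = topspace (Alexandroff_compactification euclideanreal) - Some ` {c<..}" for c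
    by (force simp: ext_ge_def ext_le_def not_le image_iff)+
  then have "closedin (Alexandroff_compactification euclideanreal) (ext_ge c)"
       "closedin (Alexandroff_compactification euclideanreal) (ext_le c)" for c
    by (simp_all only: closedin_topspace closedin_diff openin_Alexandroff_compactification_image_Some
        open_openin[symmetric] open_lessThan open_greaterThan)
  then show ?thesis
    by (simp add: rect_def ext_plane_topology_def closedin_prod_Times_iff)
qed

text \<open>Lets an infinite word be replaced by a finite prefix: a block rectangle reads only the
  digits in its own index range.\<close>

lemma block_rect_cong:
  assumes "\<And>k. m \<le> k \<Longrightarrow> k \<le> n \<Longrightarrow> w k = w' k"
  shows "block_rect a m n w = block_rect a m n w'"
  unfolding block_rect_def using assms by simp

lemma block_rect_antimono:
  assumes "m' \<le> m" "n \<le> n'"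
  shows "block_rect a m' n' w \<subseteq> block_rect a m n w"
  unfolding block_rect_def using assms by (intro closure_of_mono) fastforce

lemma block_rect_subset_rect: "block_rect a 0 0 w \<subseteq> rect (w 0)"
proof -
  have "block_rect a 0 0 w = ext_plane_topology closure_of int_rect (w 0)"
    by (simp add: block_rect_def f_iter_def)
  also have "\<dots> \<subseteq> rect (w 0)"
    unfolding int_rect_def
    by (intro closure_of_minimal closedin_rect interior_of_subset)
  finally show ?thesis .
qed

text \<open>Indexing by \<open>nat\<close> presents the rectangle of a half-word as the intersection
  of a nested sequence, which the compactness argument needs.\<close>

lemma R_plus_eq: "R_plus a u = (\<Inter>n. block_rect a 0 (int n) (\<lambda>k. u (nat k)))"
  unfolding R_plus_def by (auto simp: image_iff) (metis nat_0_le)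

lemma R_minus_eq: "R_minus a v = (\<Inter>n. block_rect a (- int n) 0 (\<lambda>k. v (nat (- k))))"
proof -
  have "{..0} = range (\<lambda>n. - int n)"
    by (auto simp: image_iff) (metis add.inverse_inverse neg_0_le_iff_le nonneg_int_cases)
  then show ?thesis unfolding R_minus_def by simp
qed

text \<open>Each arc lies in the rectangle of its digit at 0. The two extended rectangles share
  points at infinity; only their affine parts are disjoint, and this suffices since arcs are
  affine.\<close>

lemma s_arc_u_arc_disjoint:
  assumes "u 0 \<noteq> v 0"
  shows "fst (s_arc a u) \<inter> fst (u_arc a v) = {}"
proof -
  have "R_plus a u \<subseteq> rect (u 0)" "R_minus a v \<subseteq> rect (v 0)"
    using block_rect_subset_rect[of a "\<lambda>k. u (nat k)"] block_rect_subset_rect[of a "\<lambda>k. v (nat (- k))"]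
    unfolding R_plus_def R_minus_def by (auto 0 3)
  moreover have "real_part (rect True) \<inter> real_part (rect False) = {}"
    by (auto simp: real_part_def emb_def rect_def ext_ge_def ext_le_def)
  ultimately show ?thesis
    using assms by (cases "u 0"; cases "v 0") (auto simp: s_arc_def u_arc_def real_part_def)
qed

text \<open>Cantor's intersection theorem for closed rectangles cut down by \<open>K\<close>. It
  turns a condition on whole words into countably many conditions, the \<open>n\<close>-th reading
  only digits 0 to \<open>n\<close> of each half-word.\<close>

lemma compact_meets_arcs_iff:
  assumes "compact K"
  shows "K \<inter> (fst (s_arc a u) \<inter> fst (u_arc a v)) \<noteq> {} \<longleftrightarrow>
    (\<forall>n. K \<inter> (real_part (block_rect a 0 (int n) (\<lambda>k. u (nat k))) \<inter>
              real_part (block_rect a (- int n) 0 (\<lambda>k. v (nat (- k))))) \<noteq> {})"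
proof -
  define F where "F n = K \<inter> (real_part (block_rect a 0 (int n) (\<lambda>k. u (nat k))) \<inter>
              real_part (block_rect a (- int n) 0 (\<lambda>k. v (nat (- k)))))" for n
  have "K \<inter> (fst (s_arc a u) \<inter> fst (u_arc a v)) = \<Inter>(range F)"
    by (auto simp: F_def s_arc_def u_arc_def R_plus_eq R_minus_eq real_part_def)
  moreover have "\<Inter>(range F) \<noteq> {}" if "\<And>n. F n \<noteq> {}"
  proof (rule compact_nest)
    show "compact (F n)" for n
      unfolding F_def by (intro compact_Int_closed assms closed_Int closed_real_part_block_rect)
    show "F n \<subseteq> F m" if "m \<le> n" for m n
    proof -
      have "block_rect a 0 (int n) (\<lambda>k. u (nat k)) \<subseteq> block_rect a 0 (int m) (\<lambda>k. u (nat k))"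
        "block_rect a (- int n) 0 (\<lambda>k. v (nat (- k))) \<subseteq> block_rect a (- int m) 0 (\<lambda>k. v (nat (- k)))"
        using that by (intro block_rect_antimono; simp)+
      then show ?thesis unfolding F_def real_part_def by auto
    qed
  qed (rule that)
  ultimately show ?thesis unfolding F_def by auto
qed

section \<open>Gluing half-words\<close>

text \<open>Inverse of splitting a word into its halves. Both halves carry a digit at 0; the one of
  \<open>u\<close> is kept, so \<open>v\<close> is recovered only if the two digits agree.\<close>

definition glue :: "(nat \<Rightarrow> bool) \<Rightarrow> (nat \<Rightarrow> bool) \<Rightarrow> int \<Rightarrow> bool" where
  "glue u v = (\<lambda>k. if k \<ge> 0 then u (nat k) else v (nat (- k)))"

lemma word_plus_glue [simp]: "word_plus (glue u v) = u"
  by (simp add: word_plus_def glue_def)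

lemma word_minus_glue: "u 0 = v 0 \<Longrightarrow> word_minus (glue u v) = v"
  by (auto simp: word_minus_def glue_def fun_eq_iff)

lemma glue_word_plus_minus: "glue (word_plus w) (word_minus w) = w"
  by (auto simp: word_plus_def word_minus_def glue_def)

lemma word_plus_minus_Sigma_half:
  assumes "w \<in> Sigma_full"
  shows "word_plus w \<in> Sigma_half" "word_minus w \<in> Sigma_half"
proof -
  have *: "\<not> (w j \<and> w (j + 1))" for j using assms by (simp add: Sigma_full_def)
  show "word_plus w \<in> Sigma_half"
    using *[of "int j" for j] by (auto simp: Sigma_half_def word_plus_def add.commute)
  show "word_minus w \<in> Sigma_half"
    using *[of "- int (Suc j)" for j] by (auto simp: Sigma_half_def word_minus_def)
qed

lemma glue_Sigma_full:
  assumes "u \<in> Sigma_half" "v \<in> Sigma_half" "u 0 = v 0"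
  shows "glue u v \<in> Sigma_full"
  unfolding Sigma_full_def
proof (clarify, goal_cases)
  case (1 j)
  show ?case
  proof (cases "j \<ge> 0")
    case True
    then have "nat (j + 1) = Suc (nat j)" by simp
    with 1 True have "u (nat j)" "u (Suc (nat j))" by (auto simp: glue_def)
    with assms(1) show ?thesis by (auto simp: Sigma_half_def)
  next
    case False
    \<comment> \<open>Left of the origin the half-word is stored reversed, so successive indices
      swap order. At the seam \<open>j = -1\<close> the right neighbour is \<open>u 0\<close>, which
      equals \<open>v 0\<close>.\<close>
    then have eq: "nat (- j) = Suc (nat (- (j + 1)))" by auto
    have "v (nat (- j))" "v (nat (- (j + 1)))"
      using 1 False assms(3) by (auto simp: glue_def split: if_splits)
    with eq assms(2) show ?thesis by (auto simp: Sigma_half_def)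
  qed
qed

lemma glue_Sigma':
  assumes "u \<in> Sigma_half_nonalt" "v \<in> Sigma_half_nonalt" "u 0 = v 0"
  shows "glue u v \<in> Sigma'"
  using assms glue_Sigma_full[of u v]
  by (auto simp: Sigma'_def Sigma_half_nonalt_def word_minus_glue)

lemma Sigma'_nonalt:
  assumes "w \<in> Sigma'"
  shows "word_plus w \<in> Sigma_half_nonalt" "word_minus w \<in> Sigma_half_nonalt"
    "word_plus w 0 = word_minus w 0"
  using assms word_plus_minus_Sigma_half[of w]
  by (auto simp: Sigma'_def Sigma_half_nonalt_def word_plus_def word_minus_def)

definition matching_pairs :: "((nat \<Rightarrow> bool) \<times> (nat \<Rightarrow> bool)) set" where
  "matching_pairs = {(u, v). u \<in> Sigma_half_nonalt \<and> v \<in> Sigma_half_nonalt \<and> u 0 = v 0}"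

lemma Sigma'_eq_matching_pairs:
  assumes "w \<in> Sigma_full"
  shows "w \<in> Sigma' \<longleftrightarrow> (word_plus w, word_minus w) \<in> matching_pairs"
  using assms Sigma'_nonalt[of w] by (auto simp: matching_pairs_def Sigma'_def Sigma_half_nonalt_def)

section \<open>The wedge product of two leaves\<close>

text \<open>The orientation hypothesis is tested on the singleton of \<open>R_point a w\<close>.
  There the wedge has mass 1, so the arcs meet transversally at a point of that singleton and
  nowhere else.\<close>

lemma arcs_meet_at_R_point:
  assumes "is_rect_orientation a ori" "w \<in> Sigma'"
  shows "fst (s_arc a (word_plus w)) \<inter> fst (u_arc a (word_minus w)) = {R_point a w}"
proof -
  have "arc_wedge (plane_orientation ori) (s_arc a (word_plus w)) (u_arc a (word_minus w)) {R_point a w} = 1"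
    using assms unfolding is_rect_orientation_def by auto
  then show ?thesis
    by (auto simp: arc_wedge_def meet_transversally_def split: if_splits)
qed

lemma arc_wedge_disjoint:
  assumes "fst \<gamma>1 \<inter> fst \<gamma>2 = {}"
  shows "arc_wedge ori \<gamma>1 \<gamma>2 A = 0"
  using assms by (simp add: arc_wedge_def meet_transversally_def)

text \<open>The orientation hypothesis concerns the two halves of one word. Gluing realises every
  pair with a common digit at 0 in this way, and for the other pairs the leaves are
  disjoint.\<close>

lemma arc_wedge_leaves:
  assumes "is_rect_orientation a ori" "A \<in> sets borel"
    and "u \<in> Sigma_half_nonalt" "v \<in> Sigma_half_nonalt"
  shows "arc_wedge (plane_orientation ori) (s_arc a u) (u_arc a v) A =
    indicator {(u, v) \<in> matching_pairs. R_point a (glue u v) \<in> A} (u, v)"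
proof (cases "u 0 = v 0")
  case True
  have "glue u v \<in> Sigma'" using assms True by (simp add: glue_Sigma')
  then have "arc_wedge (plane_orientation ori) (s_arc a u) (u_arc a v) A = indicator A (R_point a (glue u v))"
    using assms(1,2) True unfolding is_rect_orientation_def by (metis word_plus_glue word_minus_glue)
  then show ?thesis using assms True by (simp add: matching_pairs_def indicator_def)
next
  case False
  then show ?thesis
    by (simp add: arc_wedge_disjoint s_arc_u_arc_disjoint matching_pairs_def)
qed

section \<open>Measurability of the coding map\<close>

lemma measurable_half_coord:
  assumes "sets M = sets Sigma_half_algebra"
  shows "(\<lambda>u. u k) \<in> measurable M (count_space UNIV)"
proof -
  have "(\<lambda>u. u k) \<in> measurable Sigma_half_algebra (count_space UNIV)"
    unfolding Sigma_half_algebra_def by (intro measurable_restrict_space1) simp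
  then show ?thesis using measurable_cong_sets[OF assms refl] by blast
qed

text \<open>Prefixes take values in the countable type \<open>bool list\<close>, so every condition
  on finitely many digits becomes measurable, whatever its geometric content.\<close>

lemma measurable_half_prefix:
  assumes "sets M = sets Sigma_half_algebra"
  shows "(\<lambda>u. map u [0..<n]) \<in> measurable M (count_space UNIV)"
proof (induction n)
  case (Suc n)
  note [measurable] = Suc measurable_half_coord[OF assms]
  have "(\<lambda>u. map u [0..<n] @ [u n]) \<in> measurable M (count_space UNIV)"
    by measurable
  then show ?case by simp
qed simp

lemma sets_half_nonalt:
  assumes "sets M = sets Sigma_half_algebra"
  shows "Sigma_half_nonalt \<in> sets M"
proof -
  note [measurable] = measurable_half_coord[OF assms]
  have "space M = Sigma_half"
    using sets_eq_imp_space_eq[OF assms]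
    by (simp add: Sigma_half_algebra_def space_restrict_space space_PiM)
  then have "Sigma_half_nonalt = {u \<in> space M. \<not> (\<forall>j. u (Suc j) \<noteq> u j)}"
    by (auto simp: Sigma_half_nonalt_def alternating_def)
  also have "\<dots> \<in> sets M" by measurable
  finally show ?thesis .
qed

lemma measurable_word_halves:
  assumes "sets N = sets Sigma_full_algebra" "sets M = sets Sigma_half_algebra" "sets M' = sets Sigma_half_algebra"
  shows "(\<lambda>w. (word_plus w, word_minus w)) \<in> measurable N (M \<Otimes>\<^sub>M M')"
proof -
  have sp: "space Sigma_full_algebra = Sigma_full"
    by (simp add: Sigma_full_algebra_def space_restrict_space space_PiM)
  have coord: "(\<lambda>w. w k) \<in> measurable Sigma_full_algebra (count_space UNIV)" for k
    unfolding Sigma_full_algebra_def by (intro measurable_restrict_space1) simp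
  have "word_plus \<in> measurable Sigma_full_algebra Sigma_half_algebra"
    "word_minus \<in> measurable Sigma_full_algebra Sigma_half_algebra"
    unfolding Sigma_half_algebra_def
    by (intro measurable_restrict_space2 measurable_PiM_single' funcsetI;
        simp add: sp word_plus_minus_Sigma_half; simp add: word_plus_def word_minus_def coord)+
  then have "word_plus \<in> measurable N M" "word_minus \<in> measurable N M'"
    using measurable_cong_sets[OF assms(1,2)] measurable_cong_sets[OF assms(1,3)] by auto
  then show ?thesis by simp
qed

lemma sets_matching_pairs:
  assumes "sets M = sets Sigma_half_algebra" "sets M' = sets Sigma_half_algebra"
  shows "matching_pairs \<in> sets (M \<Otimes>\<^sub>M M')"
proof -
  note [measurable] = measurable_half_coord[OF assms(1)] measurable_half_coord[OF assms(2)]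
    sets_half_nonalt[OF assms(1)] sets_half_nonalt[OF assms(2)]
  have "matching_pairs = (Sigma_half_nonalt \<times> Sigma_half_nonalt) \<inter>
      {p \<in> space (M \<Otimes>\<^sub>M M'). fst p 0 = snd p 0}"
    using sets.sets_into_space[OF sets_half_nonalt[OF assms(1)]]
      sets.sets_into_space[OF sets_half_nonalt[OF assms(2)]]
    by (auto simp: matching_pairs_def space_pair_measure)
  also have "\<dots> \<in> sets (M \<Otimes>\<^sub>M M')" by measurable
  finally show ?thesis .
qed

lemma sets_compact_meets_arcs:
  assumes "sets M = sets Sigma_half_algebra" "sets M' = sets Sigma_half_algebra" "compact K"
  shows "{(u, v) \<in> space (M \<Otimes>\<^sub>M M'). K \<inter> (fst (s_arc a u) \<inter> fst (u_arc a v)) \<noteq> {}} \<in> sets (M \<Otimes>\<^sub>M M')"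
proof -
  note [measurable] = measurable_half_prefix[OF assms(1)] measurable_half_prefix[OF assms(2)]
  \<comment> \<open>The depth-\<open>n\<close> condition as a predicate on finite lists. Blocks
    include both end indices, hence the prefixes of length \<open>Suc n\<close> in
    \<open>D\<close>.\<close>
  define P where "P n = (\<lambda>(k, l).
     K \<inter> (real_part (block_rect a 0 (int n) (\<lambda>i. k ! nat i)) \<inter>
          real_part (block_rect a (- int n) 0 (\<lambda>i. l ! nat (- i)))) \<noteq> {})" for n and k l :: "bool list"
  define D where "D n = {p \<in> space (M \<Otimes>\<^sub>M M'). P n (map (fst p) [0..<Suc n], map (snd p) [0..<Suc n])}" for n
  have "D n \<in> sets (M \<Otimes>\<^sub>M M')" for n
  proof -
    have "(\<lambda>p. (map (fst p) [0..<Suc n], map (snd p) [0..<Suc n]))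
        \<in> measurable (M \<Otimes>\<^sub>M M') (count_space UNIV \<Otimes>\<^sub>M count_space UNIV)"
      by measurable
    \<comment> \<open>The product of two countable discrete spaces is discrete, so the set
      \<open>Collect (P n)\<close> is measurable without any study of the rectangles.\<close>
    then have "(\<lambda>p. (map (fst p) [0..<Suc n], map (snd p) [0..<Suc n]))
        \<in> measurable (M \<Otimes>\<^sub>M M') (count_space UNIV)"
      by (simp add: pair_measure_countable)
    then show ?thesis
      using measurable_sets[of _ "M \<Otimes>\<^sub>M M'" "count_space UNIV" "Collect (P n)"]
      unfolding D_def by (auto simp: vimage_def Int_def conj_commute simp del: upt_Suc)
  qed
  moreover have "{(u, v) \<in> space (M \<Otimes>\<^sub>M M'). K \<inter> (fst (s_arc a u) \<inter> fst (u_arc a v)) \<noteq> {}} = (\<Inter>n. D n)"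
  proof -
    have "block_rect a 0 (int n) (\<lambda>i. map u [0..<Suc n] ! nat i) = block_rect a 0 (int n) (\<lambda>k. u (nat k))"
      "block_rect a (- int n) 0 (\<lambda>i. map v [0..<Suc n] ! nat (- i)) =
        block_rect a (- int n) 0 (\<lambda>k. v (nat (- k)))" for n and u v :: "nat \<Rightarrow> bool"
      by (intro block_rect_cong nth_map_upt[THEN trans]; simp)+
    then show ?thesis
      unfolding compact_meets_arcs_iff[OF assms(3)] D_def P_def by (auto simp del: upt_Suc)
  qed
  ultimately show ?thesis by auto
qed

text \<open>The two arcs of a matching pair meet only at the coded point, so this point lies in a
  compact \<open>K\<close> exactly when the arcs meet inside \<open>K\<close>.\<close>

lemma measurable_R_point_glue:
  assumes "is_rect_orientation a ori" "sets M = sets Sigma_half_algebra" "sets M' = sets Sigma_half_algebra"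
  shows "(\<lambda>(u, v). R_point a (glue u v)) \<in> borel_measurable (restrict_space (M \<Otimes>\<^sub>M M') matching_pairs)"
    (is "?f \<in> borel_measurable ?M")
proof -
  have sp: "space ?M = matching_pairs"
    using sets.sets_into_space[OF sets_matching_pairs[OF assms(2,3)]]
    by (auto simp: space_restrict_space)
  have cpt: "?f -` K \<inter> space ?M \<in> sets ?M" if "compact K" for K
  proof -
    have "fst (s_arc a u) \<inter> fst (u_arc a v) = {R_point a (glue u v)}" if "(u, v) \<in> matching_pairs" for u v
      using that arcs_meet_at_R_point[OF assms(1) glue_Sigma', of u v]
      by (simp add: matching_pairs_def word_minus_glue)
    then have "?f -` K \<inter> space ?M = matching_pairs \<inter>
        {(u, v) \<in> space (M \<Otimes>\<^sub>M M'). K \<inter> (fst (s_arc a u) \<inter> fst (u_arc a v)) \<noteq> {}}"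
      using sets.sets_into_space[OF sets_matching_pairs[OF assms(2,3)]] unfolding sp by force
    then show ?thesis
      using sets_compact_meets_arcs[OF assms(2,3) that] by (auto simp: sets_restrict_space)
  qed
  show ?thesis
    \<comment> \<open>Closed sets generate the Borel sets, and each is the countable union of its
      compact intersections with the balls of radius \<open>n\<close>.\<close>
    unfolding borel_eq_closed
  proof (rule measurable_measure_of, safe)
    fix C :: "plane set" assume "closed C"
    then have "compact (C \<inter> cball 0 (real n))" for n by (simp add: closed_Int_compact)
    then have "(\<Union>n. ?f -` (C \<inter> cball 0 (real n)) \<inter> space ?M) \<in> sets ?M"
      using cpt by blast
    moreover have "(\<Union>n. ?f -` (C \<inter> cball 0 (real n)) \<inter> space ?M) = ?f -` C \<inter> space ?M"
      using real_arch_simple by (auto simp: Int_def)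
    ultimately show "?f -` C \<inter> space ?M \<in> sets ?M" by simp
  qed auto
qed

section \<open>The wedge product\<close>

text \<open>The currents are indexed by restricted measures, whereas the product structure of the
  entropy measure uses the unrestricted ones. Measurability comes from the inclusion map; the
  measures agree by integrating over slices, which are empty outside \<open>N\<close> and contained
  in \<open>N'\<close>.\<close>

lemma
  assumes "sigma_finite_measure M'" "N \<in> sets M" "N' \<in> sets M'" "E \<in> sets (M \<Otimes>\<^sub>M M')" "E \<subseteq> N \<times> N'"
  shows sets_pair_restrict_space: "E \<in> sets (restrict_space M N \<Otimes>\<^sub>M restrict_space M' N')"
    and emeasure_pair_restrict_space:
      "emeasure (restrict_space M N \<Otimes>\<^sub>M restrict_space M' N') E = emeasure (M \<Otimes>\<^sub>M M') E"
proof -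
  interpret sigma_finite_measure M' by fact
  interpret r: sigma_finite_measure "restrict_space M' N'"
    by (rule sigma_finite_measure_restrict_space) (use assms in auto)
  have sub: "N \<subseteq> space M" "N' \<subseteq> space M'" using assms sets.sets_into_space by auto
  have "(\<lambda>x. x) \<in> measurable (restrict_space M N \<Otimes>\<^sub>M restrict_space M' N') (M \<Otimes>\<^sub>M M')"
    by (rule measurable_pair) (auto simp: o_def intro!: measurable_compose[OF measurable_fst] measurable_compose[OF measurable_snd] measurable_restrict_space1)
  from measurable_sets[OF this assms(4)]
  show *: "E \<in> sets (restrict_space M N \<Otimes>\<^sub>M restrict_space M' N')"
    using assms(5) sub by (auto simp: space_pair_measure space_restrict_space Int_absorb1 Int_absorb2)
  have "emeasure (restrict_space M N \<Otimes>\<^sub>M restrict_space M' N') E =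
      (\<integral>\<^sup>+x. emeasure (restrict_space M' N') (Pair x -` E) \<partial>restrict_space M N)"
    by (rule r.emeasure_pair_measure_alt[OF *])
  also have "\<dots> = (\<integral>\<^sup>+x. emeasure M' (Pair x -` E) \<partial>restrict_space M N)"
    using assms sub by (intro nn_integral_cong emeasure_restrict_space) auto
  also have "\<dots> = (\<integral>\<^sup>+x. emeasure M' (Pair x -` E) * indicator N x \<partial>M)"
    using assms sub by (intro nn_integral_restrict_space) auto
  also have "\<dots> = (\<integral>\<^sup>+x. emeasure M' (Pair x -` E) \<partial>M)"
  proof (intro nn_integral_cong)
    fix x
    show "emeasure M' (Pair x -` E) * indicator N x = emeasure M' (Pair x -` E)"
    proof (cases "x \<in> N")
      case False
      then have "Pair x -` E = {}" using assms(5) by auto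
      then show ?thesis by simp
    qed simp
  qed
  also have "\<dots> = emeasure (M \<Otimes>\<^sub>M M') E"
    by (rule emeasure_pair_measure_alt[symmetric, OF assms(4)])
  finally show "emeasure (restrict_space M N \<Otimes>\<^sub>M restrict_space M' N') E = emeasure (M \<Otimes>\<^sub>M M') E" .
qed

theorem theorem10p12:
  fixes a :: real
    and \<nu> :: "(int \<Rightarrow> bool) measure"
    and \<nu>p \<nu>m :: "(nat \<Rightarrow> bool) measure"
    and orient :: "bool \<Rightarrow> real"
    and Mp Mm :: "(nat \<Rightarrow> bool) presented_current"
  assumes "a < -1"
    and "is_max_entropy_measure \<nu>"
    and "is_balanced_measure \<nu>p"
    and "is_balanced_measure \<nu>m"
    and "has_product_structure \<nu> \<nu>p \<nu>m"
    and "is_rect_orientation a orient"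
    and "is_stable_current a \<nu>p Mp"
    and "is_unstable_current a \<nu>m Mm"
  shows "has_wedge_product (plane_orientation orient) Mp Mm (mu a \<nu>)"
proof -
  interpret \<nu>: prob_space \<nu> using assms(2) by (simp add: is_max_entropy_measure_def)
  interpret \<nu>p: finite_measure \<nu>p using assms(3) by (simp add: is_balanced_measure_def)
  interpret \<nu>m: finite_measure \<nu>m using assms(4) by (simp add: is_balanced_measure_def)
  have sets_\<nu>: "sets \<nu> = sets Sigma_full_algebra"
    and sets_p: "sets \<nu>p = sets Sigma_half_algebra" and sets_m: "sets \<nu>m = sets Sigma_half_algebra"
    using assms(2-4) by (auto simp: is_max_entropy_measure_def is_balanced_measure_def)
  have index: "index Mp = restrict_space \<nu>p Sigma_half_nonalt" "index Mm = restrict_space \<nu>m Sigma_half_nonalt"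
    and leaf: "leaf Mp = s_arc a" "leaf Mm = u_arc a"
    using assms(7,8) by (auto simp: is_stable_current_def is_unstable_current_def)
  have space_\<nu>: "space \<nu> = Sigma_full"
    using sets_eq_imp_space_eq[OF sets_\<nu>]
    by (simp add: Sigma_full_algebra_def space_restrict_space space_PiM)
  note halves = measurable_word_halves[OF sets_\<nu> sets_p sets_m]
  note MP = sets_matching_pairs[OF sets_p sets_m]
  note R_glue = measurable_R_point_glue[OF assms(6) sets_p sets_m]
  have \<Sigma>'_vimage: "Sigma' = (\<lambda>w. (word_plus w, word_minus w)) -` matching_pairs \<inter> space \<nu>"
    using Sigma'_eq_matching_pairs by (auto simp: space_\<nu> Sigma'_def)
  then have \<Sigma>'_sets: "Sigma' \<in> sets \<nu>" using measurable_sets[OF halves MP] by simp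
  have R_meas: "R_point a \<in> borel_measurable (restrict_space \<nu> Sigma')"
  proof -
    \<comment> \<open>Measurability was obtained on pairs of half-words; it passes to
      \<open>Sigma'\<close> because gluing the halves of a word gives the word back.\<close>
    have "(\<lambda>w. (word_plus w, word_minus w)) \<in>
        measurable (restrict_space \<nu> Sigma') (restrict_space (\<nu>p \<Otimes>\<^sub>M \<nu>m) matching_pairs)"
      using halves \<Sigma>'_vimage
      by (intro measurable_restrict_space2 measurable_restrict_space1) (auto simp: space_restrict_space)
    from measurable_compose[OF this R_glue] show ?thesis
      by (simp add: glue_word_plus_minus)
  qed
  have "finite_measure (restrict_space \<nu> Sigma')"
    by (rule finite_measure_restrict_space[OF \<nu>.finite_measure_axioms \<Sigma>'_sets])
  then have finite: "finite_measure (mu a \<nu>)"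
    unfolding mu_def using R_meas by (rule finite_measure.finite_measure_distr)
  have "has_bochner_integral (index Mp \<Otimes>\<^sub>M index Mm)
      (\<lambda>(i, j). arc_wedge (plane_orientation orient) (leaf Mp i) (leaf Mm j) A) (measure (mu a \<nu>) A)"
    if A: "A \<in> sets borel" for A
  proof -
    \<comment> \<open>The pairs coding points of \<open>A\<close>. Both the mass
      \<open>mu a \<nu>\<close> of \<open>A\<close> and the integral of the wedge reduce to the
      product measure of \<open>E\<close>.\<close>
    define E where "E = {(u, v) \<in> matching_pairs. R_point a (glue u v) \<in> A}"
    have E_sets: "E \<in> sets (\<nu>p \<Otimes>\<^sub>M \<nu>m)"
    proof -
      have "E = (\<lambda>(u, v). R_point a (glue u v)) -` A \<inter> space (restrict_space (\<nu>p \<Otimes>\<^sub>M \<nu>m) matching_pairs)"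
        using sets.sets_into_space[OF MP] by (auto simp: E_def space_restrict_space)
      also have "\<dots> \<in> sets (restrict_space (\<nu>p \<Otimes>\<^sub>M \<nu>m) matching_pairs)"
        by (rule measurable_sets[OF R_glue A])
      finally show ?thesis using MP by (simp add: sets_restrict_space_iff)
    qed
    have E_sub: "E \<subseteq> Sigma_half_nonalt \<times> Sigma_half_nonalt"
      by (auto simp: E_def matching_pairs_def)
    note restr = \<nu>m.sigma_finite_measure_axioms sets_half_nonalt[OF sets_p] sets_half_nonalt[OF sets_m] E_sets E_sub
    have "emeasure (mu a \<nu>) A = emeasure \<nu> (R_point a -` A \<inter> Sigma')"
      using \<Sigma>'_sets sets.sets_into_space[OF \<Sigma>'_sets] unfolding mu_def
      by (subst emeasure_distr[OF R_meas A])
        (auto simp: space_restrict_space Int_absorb2 intro!: emeasure_restrict_space)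
    also have "R_point a -` A \<inter> Sigma' = {w \<in> space \<nu>. (word_plus w, word_minus w) \<in> E}"
      unfolding \<Sigma>'_vimage by (auto simp: E_def glue_word_plus_minus)
    \<comment> \<open>The product structure only counts pairs with a common digit at 0. All of
      \<open>E\<close> is of this kind, so the restriction disappears next.\<close>
    also have "emeasure \<nu> \<dots> = emeasure (\<nu>p \<Otimes>\<^sub>M \<nu>m) {(u, v) \<in> E. u 0 = v 0}"
      using assms(5) E_sets by (simp add: has_product_structure_def)
    also have "{(u, v) \<in> E. u 0 = v 0} = E"
      by (auto simp: E_def matching_pairs_def)
    also have "emeasure (\<nu>p \<Otimes>\<^sub>M \<nu>m) E = emeasure (index Mp \<Otimes>\<^sub>M index Mm) E"
      unfolding index by (rule emeasure_pair_restrict_space[OF restr, symmetric])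
    finally have eq: "emeasure (mu a \<nu>) A = emeasure (index Mp \<Otimes>\<^sub>M index Mm) E" .
    have "has_bochner_integral (index Mp \<Otimes>\<^sub>M index Mm) (indicator E) (measure (index Mp \<Otimes>\<^sub>M index Mm) E)"
    proof (rule has_bochner_integral_real_indicator)
      show "E \<in> sets (index Mp \<Otimes>\<^sub>M index Mm)"
        unfolding index by (rule sets_pair_restrict_space[OF restr])
      show "emeasure (index Mp \<Otimes>\<^sub>M index Mm) E < \<infinity>"
        using finite_measure.emeasure_finite[OF finite, of A] by (simp add: eq top.not_eq_extremum)
    qed
    moreover have "measure (index Mp \<Otimes>\<^sub>M index Mm) E = measure (mu a \<nu>) A"
      by (simp add: measure_def eq)
    \<comment> \<open>The index spaces contain only non-alternating words, so the two integrands
      agree at every point and no null set has to be removed.\<close>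
    moreover have "arc_wedge (plane_orientation orient) (leaf Mp i) (leaf Mm j) A = indicator E (i, j)"
      if "(i, j) \<in> space (index Mp \<Otimes>\<^sub>M index Mm)" for i j
      using that arc_wedge_leaves[OF assms(6) A]
      by (auto simp: index leaf E_def space_pair_measure space_restrict_space)
    ultimately show ?thesis
      by (subst has_bochner_integral_cong[OF refl _ refl, where g = "indicator E"]) auto
  qed
  with finite show ?thesis
    by (simp add: has_wedge_product_def mu_def)
qed

end
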